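(* Let $a>0$, $0<\beta<2$, $\gamma>\max(0,\beta-1)$ and $t\in[0,\infty]$, and let $$w(x)=\frac{\Gamma(\beta)}{\Gamma(\gamma)}\,\frac{\Gamma(\gamma+x)\,a^x}{\Gamma(\beta+x)\,\Gamma(x+1)}.$$ Let $(r_n)_{n\in\mathbb N}$ be the orthonormal polynomials on the bi-lattice $\mathbb N\cup(\mathbb N+1-\beta)$ defined by $$\sum_{k=0}^\infty r_n(k)r_m(k)w(k)+t\sum_{k=0}^\infty r_n(k+1-\beta)r_m(k+1-\beta)w(k+1-\beta)=\delta_{n,m},$$ and let $\tilde a_n,\tilde b_n$ be the coefficients in their recurrence relation $$xr_n(x)=\tilde a_{n+1}r_{n+1}(x)+\tilde b_nr_n(x)+\tilde a_nr_{n-1}(x).$$ Then these recurrence coefficients are given by $$\tilde a_n^2=na-(\gamma-1)\tilde u_n,\qquad \tilde b_n=n+\gamma-\beta+a-\frac{(\gamma-1)\tilde v_n}{a},$$ where $(\tilde u_n,\tilde v_n)_{n\in\mathbb N}$ satisfy the system of non-linear equations $$(\tilde u_n+\tilde v_n)(\tilde u_{n+1}+\tilde v_n)=\frac{\gamma-1}{a^2}\,\tilde v_n(\tilde v_n-a)\left(\tilde v_n-a\frac{\gamma-\beta}{\gamma-1}\right),$$ $$(\tilde u_n+\tilde v_n)(\tilde u_n+\tilde v_{n-1})=\frac{\tilde u_n}{\tilde u_n-\frac{an}{\gamma-1}}\,(\tilde u_n+a)\left(\tilde u_n+a\frac{\gamma-\beta}{\gamma-1}\right),$$ with initial conditions $\tilde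 a_0=0$ and $$\tilde b_0=\frac{m_1+t\,\hat m_1}{m_0+t\,\hat m_0},$$ where $$m_0=M(\gamma,\beta,a),\qquad m_1=\frac{\gamma a}{\beta}M(\gamma+1,\beta+1,a),$$ $$\hat m_0=\frac{\Gamma(\beta)\Gamma(\gamma-\beta+1)}{\Gamma(\gamma)\Gamma(2-\beta)}\,a^{1-\beta}M(\gamma-\beta+1,2-\beta,a),$$ $$\hat m_1=\frac{\Gamma(\beta)\Gamma(\gamma-\beta+1)}{\Gamma(\gamma)\Gamma(1-\beta)}\,a^{1-\beta}M(\gamma-\beta+1,1-\beta,a).$$
   Context: $\mathbb N=\{0,1,2,\ldots\}$ and $\mathbb N+1-\beta=\{1-\beta,2-\beta,3-\beta,\ldots\}$; $\delta_{n,m}$ is the Kronecker delta; $r_n$ has degree $n$ and positive leading coefficient. The orthogonality measure is $\mu_1+t\mu_2$, where $\mu_1$ is the discrete measure on $\mathbb N$ with weights $w(k)$ and $\mu_2$ is the discrete measure on $\mathbb N+1-\beta$ with weights $w(k+1-\beta)$, $k\in\mathbb N$; the limiting cases $t\to0$ and $t\to\infty$ correspond to the single lattices $\mathbb N$ and $\mathbb N+1-\beta$ respectively. $M(a,b,z)=\sum_{k=0}^\infty\frac{(a)_k}{(b)_k\,k!}z^k={}_1F_1(a;b;z)$ is the confluent hypergeometric function, where $(x)_k=x(x+1)\cdots(x+k-1)$, $(x)_0=1$.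
   Formalization: γ ≠ 1 is assumed, since the quotients by γ−1 are undefined at γ = 1; the second equation is taken for n ≥ 1 (at n = 0 it has ṽ_{−1} and 0/0); at β = 1 the quotient M(γ−β+1,1−β,a)/Γ(1−β) in m̂_1 is read as its continuous extension. *)

theory Defs
  imports "HOL-Analysis.Analysis" "HOL-Computational_Algebra.Polynomial"
    "HOL-Real_Asymp.Real_Asymp"
begin

definition weight :: "real \<Rightarrow> real \<Rightarrow> real \<Rightarrow> real \<Rightarrow> real" where
  "weight a \<beta> \<gamma> x =
     Gamma \<beta> / Gamma \<gamma> * (Gamma (\<gamma> + x) * a powr x / (Gamma (\<beta> + x) * Gamma (x + 1)))"

definition inner_N :: "real \<Rightarrow> real \<Rightarrow> real \<Rightarrow> real poly \<Rightarrow> real poly \<Rightarrow> real" where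
  "inner_N a \<beta> \<gamma> p q =
     (\<Sum>k. poly p (real k) * poly q (real k) * weight a \<beta> \<gamma> (real k))"

definition inner_shifted :: "real \<Rightarrow> real \<Rightarrow> real \<Rightarrow> real poly \<Rightarrow> real poly \<Rightarrow> real" where
  "inner_shifted a \<beta> \<gamma> p q =
     (\<Sum>k. poly p (real k + 1 - \<beta>) * poly q (real k + 1 - \<beta>) * weight a \<beta> \<gamma> (real k + 1 - \<beta>))"

text \<open>The value \<open>t = \<infinity>\<close> stands for the shifted lattice alone: it is the limit
  of \<open>\<mu>\<^sub>1 + t \<mu>\<^sub>2\<close> after division by \<open>t\<close>, which leaves the recurrence
  coefficients of the orthonormal polynomials unchanged.\<close>

definition inner_bilattice ::
  "real \<Rightarrow> real \<Rightarrow> real \<Rightarrow> ennreal \<Rightarrow> real poly \<Rightarrow> real poly \<Rightarrow> real" where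
  "inner_bilattice a \<beta> \<gamma> t p q =
     (if t = \<infinity> then inner_shifted a \<beta> \<gamma> p q
      else inner_N a \<beta> \<gamma> p q + enn2real t * inner_shifted a \<beta> \<gamma> p q)"

definition orthonormal_polys ::
  "real \<Rightarrow> real \<Rightarrow> real \<Rightarrow> ennreal \<Rightarrow> (nat \<Rightarrow> real poly) \<Rightarrow> bool" where
  "orthonormal_polys a \<beta> \<gamma> t r \<longleftrightarrow>
     (\<forall>n. degree (r n) = n \<and> lead_coeff (r n) > 0) \<and>
     (\<forall>n m. inner_bilattice a \<beta> \<gamma> t (r n) (r m) = (if n = m then 1 else 0))"

text \<open>In the relation for \<open>n = 0\<close> the term \<open>A 0 * r\<^sub>-\<^sub>1\<close> is absent, so the relation
  does not determine \<open>A 0\<close>; it is \<open>0\<close> by convention.\<close>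

definition recurrence_coeffs ::
  "(nat \<Rightarrow> real poly) \<Rightarrow> (nat \<Rightarrow> real) \<Rightarrow> (nat \<Rightarrow> real) \<Rightarrow> bool" where
  "recurrence_coeffs r A B \<longleftrightarrow>
     A 0 = 0 \<and>
     (\<forall>n x. x * poly (r n) x =
        A (Suc n) * poly (r (Suc n)) x + B n * poly (r n) x
        + (if n = 0 then 0 else A n * poly (r (n - 1)) x))"

definition kummer_M :: "real \<Rightarrow> real \<Rightarrow> real \<Rightarrow> real" where
  "kummer_M a b z = (\<Sum>k. pochhammer a k / (pochhammer b k * fact k) * z ^ k)"

text \<open>The quotient \<open>M(a,b,z) / \<Gamma>(b)\<close>, extended continuously to \<open>b = 0, -1, -2, \<dots>\<close>,
  where \<open>M(a,b,z)\<close> and \<open>\<Gamma>(b)\<close> both have poles.\<close>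

definition kummer_M_over_Gamma :: "real \<Rightarrow> real \<Rightarrow> real \<Rightarrow> real" where
  "kummer_M_over_Gamma a b z = (\<Sum>k. pochhammer a k * rGamma (b + real k) / fact k * z ^ k)"

lemma kummer_M_summable:
  fixes a b z :: real
  assumes b: "b \<notin> \<int>\<^sub>\<le>\<^sub>0"
  shows "summable (\<lambda>k. pochhammer a k / (pochhammer b k * fact k) * z ^ k)" (is "summable ?f")
proof -
  have bk: "b + real k \<noteq> 0" for k
    using b by (metis add.commute add_eq_0_iff minus_of_nat_in_nonpos_Ints)
  define q where "q k = (a + real k) / ((b + real k) * (real k + 1)) * z" for k
  have step: "?f (Suc k) = q k * ?f k" for k
    by (simp add: q_def pochhammer_Suc field_simps)
  have "(\<lambda>k. (a + real k) / ((b + real k) * (real k + 1))) \<longlonglongrightarrow> 0"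
    by real_asymp
  from tendsto_mult_right[OF this, of z] have "q \<longlonglongrightarrow> 0"
    unfolding q_def by simp
  from tendsto_norm_zero[OF this] have "(\<lambda>k. norm (q k)) \<longlonglongrightarrow> 0" .
  then have "eventually (\<lambda>k. norm (q k) < 1/2) sequentially"
    by (rule order_tendstoD) simp
  then obtain N where "\<And>k. k \<ge> N \<Longrightarrow> norm (q k) < 1/2"
    by (auto simp: eventually_sequentially)
  then have "norm (?f (Suc k)) \<le> 1/2 * norm (?f k)" if "k \<ge> N" for k
    unfolding step norm_mult[of "q k"] using that by (intro mult_right_mono) (auto intro: less_imp_le)
  then show ?thesis
    by (intro summable_ratio_test[of "1/2" N]) auto
qed

lemma kummer_M_over_Gamma_eq:
  assumes b: "b \<notin> \<int>\<^sub>\<le>\<^sub>0"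
  shows "kummer_M_over_Gamma a b z = kummer_M a b z / Gamma b"
proof -
  have g: "Gamma b \<noteq> 0" "\<And>k. Gamma (b + real k) = pochhammer b k * Gamma b"
    using b by (auto simp: Gamma_eq_zero_iff pochhammer_Gamma)
  have "kummer_M_over_Gamma a b z
      = (\<Sum>k. pochhammer a k / (pochhammer b k * fact k) * z ^ k / Gamma b)"
    unfolding kummer_M_over_Gamma_def
    by (intro suminf_cong) (simp add: rGamma_inverse_Gamma g field_simps)
  also have "\<dots> = kummer_M a b z / Gamma b"
    unfolding kummer_M_def by (rule suminf_divide[OF kummer_M_summable[OF b]])
  finally show ?thesis .
qed

definition m0 :: "real \<Rightarrow> real \<Rightarrow> real \<Rightarrow> real" where
  "m0 a \<beta> \<gamma> = kummer_M \<gamma> \<beta> a"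

definition m1 :: "real \<Rightarrow> real \<Rightarrow> real \<Rightarrow> real" where
  "m1 a \<beta> \<gamma> = \<gamma> * a / \<beta> * kummer_M (\<gamma> + 1) (\<beta> + 1) a"

definition m0_hat :: "real \<Rightarrow> real \<Rightarrow> real \<Rightarrow> real" where
  "m0_hat a \<beta> \<gamma> = Gamma \<beta> * Gamma (\<gamma> - \<beta> + 1) / (Gamma \<gamma> * Gamma (2 - \<beta>))
     * a powr (1 - \<beta>) * kummer_M (\<gamma> - \<beta> + 1) (2 - \<beta>) a"

text \<open>Written with \<open>M / \<Gamma>\<close> so that \<open>\<beta> = 1\<close> is covered, where the factor
  \<open>M(\<gamma> - \<beta> + 1, 1 - \<beta>, a) / \<Gamma>(1 - \<beta>)\<close> only makes sense as a limit.\<close>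

definition m1_hat :: "real \<Rightarrow> real \<Rightarrow> real \<Rightarrow> real" where
  "m1_hat a \<beta> \<gamma> = Gamma \<beta> * Gamma (\<gamma> - \<beta> + 1) / Gamma \<gamma>
     * a powr (1 - \<beta>) * kummer_M_over_Gamma (\<gamma> - \<beta> + 1) (1 - \<beta>) a"

lemma m1_hat_eq:
  assumes "\<beta> < 2" "\<beta> \<noteq> 1"
  shows "m1_hat a \<beta> \<gamma> = Gamma \<beta> * Gamma (\<gamma> - \<beta> + 1) / (Gamma \<gamma> * Gamma (1 - \<beta>))
     * a powr (1 - \<beta>) * kummer_M (\<gamma> - \<beta> + 1) (1 - \<beta>) a"
proof -
  have "1 - \<beta> \<notin> \<int>\<^sub>\<le>\<^sub>0"
  proof
    assume "1 - \<beta> \<in> \<int>\<^sub>\<le>\<^sub>0"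
    then obtain n where "1 - \<beta> = - real n" by (auto elim: nonpos_Ints_cases')
    with assms show False by (cases n) auto
  qed
  then show ?thesis by (simp add: m1_hat_def kummer_M_over_Gamma_eq)
qed

end

theory Submission
  imports Defs
begin

text \<open>
  The weight satisfies \<open>x (x + \<beta> - 1) w(x) = a (x - 1 + \<gamma>) w(x - 1)\<close>, and the factor
  \<open>x (x + \<beta> - 1)\<close> vanishes at the first point of either lattice. Hence the functional
  \<open>L\<close> of any combination of the two lattices satisfies the same discrete Pearson equation
  \<open>L (x (x + \<beta> - 1) p(x)) = a L ((x + \<gamma>) p(x + 1))\<close>. For monic orthogonal polynomials
  \<open>P n\<close> this makes \<open>(x + \<gamma>) P n (x + 1)\<close> a combination of \<open>P n\<close> and \<open>P (n - 1)\<close>, and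
  \<open>x (x + \<beta> - 1) P n (x - 1)\<close> one of \<open>P (n + 1)\<close> and \<open>P n\<close>, with linear coefficients
  that involve only \<open>U n = (\<gamma> - 1) u n\<close> and \<open>V n = (\<gamma> - 1) v n\<close>. Composing the two shifts
  gives an identity between cubic polynomials in \<open>y = x + \<gamma>\<close>; its values at \<open>y = V n / a\<close>
  and \<open>y = - U (n + 1) / a\<close> are the two nonlinear equations.
\<close>

section \<open>Monic orthogonal polynomials of an abstract functional\<close>

text \<open>By Taylor expansion the second-order remainder has degree at most
  \<open>degree p - 2\<close>, so a shift changes the two top coefficients only through the
  derivative. For \<open>c + x q\<close> the remainder is \<open>s D q + x D q + s * s * q'\<close>,
  which drives the induction.\<close>

lemma coeff_taylor_remainder:
  fixes p :: "'a::idom poly"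
  shows "degree p < i + 2 \<Longrightarrow> coeff (pcompose p [:s, 1:] - p - smult s (pderiv p)) i = 0"
proof (induction p arbitrary: i)
  case 0
  then show ?case by simp
next
  case (pCons c q)
  let ?D = "\<lambda>q. pcompose q [:s, 1:] - q - smult s (pderiv q)"
  have eq: "?D (pCons c q) = smult s (?D q) + pCons 0 (?D q) + smult (s * s) (pderiv q)"
    by (simp add: pcompose_pCons pderiv_pCons algebra_simps smult_add_right smult_diff_right)
  have d: "degree q < i + 1" if "q \<noteq> 0"
    using pCons.prems that by simp
  have dq: "degree q < i + 1 \<or> q = 0" using d by blast
  have 1: "coeff (?D q) i = 0"
    using dq by (intro pCons.IH) auto
  have 2: "coeff (pCons 0 (?D q)) i = 0"
  proof (cases i)
    case (Suc j)
    then have "coeff (?D q) j = 0" using dq by (intro pCons.IH) auto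
    then show ?thesis using Suc by simp
  qed simp
  have 3: "coeff (pderiv q) i = 0"
    using dq by (auto simp: coeff_pderiv coeff_eq_0)
  show ?case unfolding eq using 1 2 3 by (simp only: coeff_add coeff_smult) simp
qed

text \<open>The functional stays abstract so that every combination of the two lattices is treated
  at once; \<open>h n\<close> is the squared norm of \<open>P n\<close>. For \<open>n = 0\<close>
  the truncated index makes \<open>P (n - 1)\<close> equal to \<open>P 0\<close>, and
  \<open>\<alpha> 0 = 0\<close> removes that term.\<close>

locale monic_orthogonal_polys =
  fixes L :: "real poly \<Rightarrow> real" and P :: "nat \<Rightarrow> real poly" and h b \<alpha> :: "nat \<Rightarrow> real"
  assumes L_add: "L (p + q) = L p + L q"
    and L_smult: "L (smult c p) = c * L p"
    and degree_P [simp]: "degree (P n) = n"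
    and lead_P: "lead_coeff (P n) = 1"
    and L_P_P: "L (P n * P m) = (if n = m then h n else 0)"
    and h_nonzero [simp]: "h n \<noteq> 0"
    and three_term: "[:0, 1:] * P n = P (Suc n) + smult (b n) (P n) + smult (\<alpha> n) (P (n - 1))"
    and \<alpha>_0: "\<alpha> 0 = 0"
begin

lemma coeff_P [simp]: "coeff (P n) n = 1"
  using lead_P[of n] by simp

lemma P_nonzero [simp]: "P n \<noteq> 0"
  using coeff_P[of n] by force

lemma P_0: "P 0 = 1"
proof -
  obtain d where "P 0 = [:d:]" using degree_P[of 0] degree_eq_zeroE by blast
  then show ?thesis using coeff_P[of 0] by (simp add: one_pCons)
qed

lemma L_0 [simp]: "L 0 = 0"
  using L_smult[of 0 0] by simp

lemma L_minus: "L (- p) = - L p"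
  using L_smult[of "-1" p] by simp

lemma L_diff: "L (p - q) = L p - L q"
  using L_add[of p "- q"] by (simp add: L_minus)

text \<open>Multiples of \<open>P m\<close> are peeled off from the top. The degree bound is stated
  through coefficients, so that the bound \<open>0\<close> means \<open>q = 0\<close>.\<close>

lemma L_lower: "\<forall>i\<ge>m. coeff q i = 0 \<Longrightarrow> m \<le> n \<Longrightarrow> L (q * P n) = 0"
proof (induction m arbitrary: q)
  case 0
  then have "q = 0" by (simp add: poly_eq_iff)
  then show ?case by simp
next
  case (Suc m)
  let ?q = "q - smult (coeff q m) (P m)"
  have "\<forall>i\<ge>m. coeff ?q i = 0"
  proof (intro allI impI)
    fix i assume "i \<ge> m"
    then show "coeff ?q i = 0"
      using Suc.prems by (cases "i = m") (auto simp: coeff_eq_0)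
  qed
  then have "L (?q * P n) = 0" using Suc.IH[of ?q] Suc.prems(2) by (metis Suc_leD)
  then show ?case using Suc.prems(2)
    by (simp add: left_diff_distrib L_diff L_smult L_P_P)
qed

text \<open>Expand \<open>q\<close> of degree at most \<open>n + 1\<close> in
  \<open>P (Suc n)\<close>, \<open>P n\<close> and lower terms: only the \<open>P n\<close>
  component survives, and its coefficient is the bracket.\<close>

lemma L_mult_P:
  assumes "\<And>i. i \<ge> n + 2 \<Longrightarrow> coeff q i = 0"
  shows "L (q * P n) = (coeff q n - coeff q (Suc n) * coeff (P (Suc n)) n) * h n"
proof -
  let ?q' = "q - smult (coeff q (Suc n)) (P (Suc n))"
  let ?q = "?q' - smult (coeff ?q' n) (P n)"
  have "\<forall>i\<ge>n. coeff ?q i = 0"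
  proof (intro allI impI)
    fix i assume "i \<ge> n"
    then consider "i = n" | "i = Suc n" | "i \<ge> n + 2" by linarith
    then show "coeff ?q i = 0"
      by cases (use assms in \<open>auto simp: coeff_eq_0\<close>)
  qed
  then have "L (?q * P n) = 0" by (rule L_lower) simp
  then show ?thesis
    by (simp add: left_diff_distrib L_diff L_smult L_P_P)
qed

text \<open>Pairing a nonzero \<open>E\<close> with the \<open>P\<close> of its own degree would
  give its leading coefficient times a nonzero norm. Both shift relations below are verified this
  way.\<close>

lemma eq_0_if_orthogonal:
  assumes deg: "\<And>i. i > N \<Longrightarrow> coeff E i = 0" and orth: "\<And>m. m \<le> N \<Longrightarrow> L (E * P m) = 0"
  shows "E = 0"
proof (rule ccontr)
  assume E: "E \<noteq> 0"
  then have le: "degree E \<le> N" using deg by (meson leading_coeff_0_iff not_le)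
  have "L (E * P (degree E)) = lead_coeff E * h (degree E)"
    by (subst L_mult_P) (auto simp: coeff_eq_0)
  then show False using orth[OF le] E by simp
qed

text \<open>The coefficient of \<open>x\<^sup>n\<^sup>-\<^sup>1\<close> in \<open>P n\<close>, read off from \<open>x P n\<close> so that it is \<open>0\<close> for \<open>n = 0\<close>.\<close>

definition c where "c n = coeff (pCons 0 (P n)) n"

lemma c_0: "c 0 = 0"
  by (simp add: c_def)

lemma coeff_P_Suc [simp]: "coeff (P (Suc n)) n = c (Suc n)"
  by (simp add: c_def)

text \<open>Compare the coefficients of \<open>x ^ n\<close> on the two sides of the three-term
  recurrence.\<close>

lemma c_Suc: "c (Suc n) = c n - b n"
proof -
  have "coeff ([:0, 1:] * P n) n = c n" by (simp add: c_def)
  moreover have "coeff (smult (\<alpha> n) (P (n - 1))) n = 0"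
    using \<alpha>_0 by (cases n) (auto simp: coeff_eq_0)
  ultimately show ?thesis
    unfolding three_term coeff_add coeff_P_Suc by (simp only: coeff_smult) simp
qed

text \<open>Evaluate \<open>L (x * P n * P (Suc n))\<close> twice, expanding \<open>x * P n\<close>
  and then \<open>x * P (Suc n)\<close>.\<close>

lemma h_Suc: "h (Suc n) = \<alpha> (Suc n) * h n"
proof -
  have "L (([:0, 1:] * P n) * P (Suc n)) = h (Suc n)"
    by (subst L_mult_P) (auto simp: coeff_eq_0 coeff_pCons split: nat.splits)
  moreover have "([:0, 1:] * P n) * P (Suc n) = ([:0, 1:] * P (Suc n)) * P n"
    by (simp add: mult_ac)
  moreover have "L (([:0, 1:] * P (Suc n)) * P n) = \<alpha> (Suc n) * h n"
    unfolding three_term by (simp add: distrib_right L_add L_smult L_P_P)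
  ultimately show ?thesis by metis
qed

text \<open>The third part reads off the coefficient of index \<open>n - 1\<close> after
  multiplication by \<open>x\<close>, as in the definition of \<open>c\<close>, so that it includes
  \<open>n = 0\<close>.\<close>

lemma coeff_shift_P:
  shows "i > n \<Longrightarrow> coeff (pcompose (P n) [:s, 1:]) i = 0"
    and "coeff (pcompose (P n) [:s, 1:]) n = 1"
    and "coeff (pCons 0 (pcompose (P n) [:s, 1:])) n = c n + s * real n"
proof -
  have *: "coeff (pcompose (P n) [:s, 1:]) i = coeff (P n) i + s * (of_nat (Suc i) * coeff (P n) (Suc i))"
    if "n < i + 2" for i
    using coeff_taylor_remainder[of "P n" i s] that by (simp add: coeff_pderiv)
  show "i > n \<Longrightarrow> coeff (pcompose (P n) [:s, 1:]) i = 0"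
    by (subst *) (auto simp: coeff_eq_0)
  show "coeff (pcompose (P n) [:s, 1:]) n = 1"
    by (subst *) (auto simp: coeff_eq_0)
  show "coeff (pCons 0 (pcompose (P n) [:s, 1:])) n = c n + s * real n"
  proof (cases n)
    case (Suc j)
    then show ?thesis using *[of j] by simp
  qed (simp add: c_0 P_0 pcompose_1)
qed

end

section \<open>Shift relations from the discrete Pearson equation\<close>

locale pearson_orthogonal_polys = monic_orthogonal_polys +
  fixes a \<beta> \<gamma> :: real
  assumes pearson: "L ([:0, \<beta> - 1, 1:] * p) = a * L ([:\<gamma>, 1:] * pcompose p [:1, 1:])"
    and a_nonzero: "a \<noteq> 0"
begin

text \<open>An adjointness: up to the factor \<open>a\<close>, the weighted downward shift is the
  adjoint of the weighted upward shift. Apply the Pearson equation to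
  \<open>p(x - 1) q(x)\<close>.\<close>

lemma pearson_swap:
  "L ([:0, \<beta> - 1, 1:] * pcompose p [:-1, 1:] * q) = a * L ([:\<gamma>, 1:] * pcompose q [:1, 1:] * p)"
proof -
  have "pcompose (pcompose p [:-1, 1:]) [:1, 1:] = p"
    by (simp add: pcompose_assoc[symmetric] pcompose_pCons)
  then show ?thesis
    using pearson[of "pcompose p [:-1, 1:] * q"] by (simp add: pcompose_mult mult_ac)
qed

definition U where "U n = real n * a - \<alpha> n"
definition V where "V n = a * (real n + \<gamma> - \<beta> + a - b n)"

lemma coeff_linear_mult: "coeff ([:g, 1:] * p) i = g * coeff p i + coeff (pCons 0 p) i"
  for g :: real
  by simp

text \<open>Multiplication by \<open>x + g\<close> has a tridiagonal matrix; \<open>h_Suc\<close>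
  turns the entry \<open>\<alpha> m * h n\<close> with \<open>m = Suc n\<close> into
  \<open>h m\<close>.\<close>

lemma L_linear_P_P:
  "L ([:g, 1:] * P m * P n) =
     (if m = n then (g + b n) * h n else if n = Suc m then h n else if m = Suc n then h m else 0)"
proof -
  have "[:g, 1:] * P m = smult g (P m) + [:0, 1:] * P m" by simp
  then have "L ([:g, 1:] * P m * P n) = g * L (P m * P n) +
      (L (P (Suc m) * P n) + b m * L (P m * P n) + \<alpha> m * L (P (m - 1) * P n))"
    unfolding three_term by (simp add: distrib_right L_add L_smult)
  then show ?thesis
    using h_Suc[of n] \<alpha>_0 by (cases m) (auto simp: L_P_P algebra_simps)
qed

lemma coeff_shift_P_linear:
  shows "i \<ge> n + 2 \<Longrightarrow> coeff ([:g, 1:] * pcompose (P n) [:s, 1:]) i = 0"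
    and "coeff ([:g, 1:] * pcompose (P n) [:s, 1:]) (Suc n) = 1"
    and "coeff ([:g, 1:] * pcompose (P n) [:s, 1:]) n = c n + s * real n + g"
  unfolding coeff_linear_mult coeff_shift_P(2,3)
  by (auto simp: coeff_pCons coeff_shift_P(1,2) split: nat.splits)

lemma coeff_shift_P_quadratic:
  shows "i \<ge> n + 3 \<Longrightarrow> coeff ([:0, g, 1:] * pcompose (P n) [:s, 1:]) i = 0"
    and "coeff ([:0, g, 1:] * pcompose (P n) [:s, 1:]) (Suc (Suc n)) = 1"
    and "coeff ([:0, g, 1:] * pcompose (P n) [:s, 1:]) (Suc n) = c n + s * real n + g"
proof -
  have eq: "coeff ([:0, g, 1:] * p) i = coeff (pCons 0 ([:g, 1:] * p)) i" for p :: "real poly" and i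
    by simp
  show "i \<ge> n + 3 \<Longrightarrow> coeff ([:0, g, 1:] * pcompose (P n) [:s, 1:]) i = 0"
    and "coeff ([:0, g, 1:] * pcompose (P n) [:s, 1:]) (Suc (Suc n)) = 1"
    and "coeff ([:0, g, 1:] * pcompose (P n) [:s, 1:]) (Suc n) = c n + s * real n + g"
    unfolding eq
    by (auto simp: coeff_pCons coeff_shift_P_linear simp del: mult_pCons_left split: nat.splits)
qed

text \<open>Adjointness moves the shift onto \<open>P m\<close>. The result has degree
  \<open>m + 1\<close>, at most \<open>n + 1\<close>, so \<open>L_mult_P\<close> evaluates the
  pairing from top coefficients.\<close>

lemma L_shift_down_P_P:
  assumes "m \<le> n"
  shows "L ([:0, \<beta> - 1, 1:] * pcompose (P n) [:-1, 1:] * P m) =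
    (if m = n then a * (b n + real n + \<gamma>) * h n else if n = Suc m then a * h n else 0)"
proof -
  have "L ([:\<gamma>, 1:] * pcompose (P m) [:1, 1:] * P n) =
    (if m = n then (b n + real n + \<gamma>) * h n else if n = Suc m then h n else 0)"
  proof (subst L_mult_P)
    show "coeff ([:\<gamma>, 1:] * pcompose (P m) [:1, 1:]) i = 0" if "n + 2 \<le> i" for i
      using assms that by (intro coeff_shift_P_linear) auto
    consider "m = n" | "n = Suc m" | "n \<ge> m + 2" using assms by linarith
    then show "(coeff ([:\<gamma>, 1:] * pcompose (P m) [:1, 1:]) n -
       coeff ([:\<gamma>, 1:] * pcompose (P m) [:1, 1:]) (Suc n) * coeff (P (Suc n)) n) * h n =
      (if m = n then (b n + real n + \<gamma>) * h n else if n = Suc m then h n else 0)"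
      by cases (auto simp: coeff_shift_P_linear c_Suc simp del: mult_pCons_left)
  qed
  then show ?thesis by (simp add: pearson_swap del: mult_pCons_left)
qed

text \<open>Here the shifted factor has degree \<open>m + 2\<close>, which is within the reach
  \<open>n + 1\<close> of \<open>L_mult_P\<close> because \<open>m < n\<close>.\<close>

lemma L_shift_up_P_P:
  assumes "m < n"
  shows "a * L ([:\<gamma>, 1:] * pcompose (P n) [:1, 1:] * P m) =
    (if n = Suc m then (b m + b n + \<beta> - 1 - real m) * h n else if n = m + 2 then h n else 0)"
  unfolding pearson_swap[symmetric]
proof (subst L_mult_P)
  let ?q = "[:0, \<beta> - 1, 1:] * pcompose (P m) [:-1, 1:]"
  show "coeff ?q i = 0" if "n + 2 \<le> i" for i
    using assms that by (intro coeff_shift_P_quadratic) auto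
  consider "n = Suc m" | "n = Suc (Suc m)" | "n \<ge> m + 3" using assms by linarith
  then show "(coeff ?q n - coeff ?q (Suc n) * coeff (P (Suc n)) n) * h n =
    (if n = Suc m then (b m + b n + \<beta> - 1 - real m) * h n else if n = m + 2 then h n else 0)"
    by cases (auto simp: coeff_shift_P_quadratic c_Suc algebra_simps simp del: mult_pCons_left)
qed

text \<open>The coefficient of \<open>x ^ n\<close> determines \<open>U n\<close>, and the pairing
  with \<open>P (n - 1)\<close> determines \<open>V n\<close>. The difference of the sides then has
  degree below \<open>n\<close> and is orthogonal to all lower \<open>P m\<close>.\<close>

lemma shift_up:
  "[:\<gamma>, 1:] * pcompose (P n) [:1, 1:] =
     [:\<gamma> + U n / a, 1:] * P n + smult (\<alpha> n / a) ([:\<gamma> - V n / a, 1:] * P (n - 1))"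
proof (cases n)
  case 0
  then show ?thesis by (simp only: P_0 U_def \<alpha>_0 pcompose_1) simp
next
  case (Suc k)
  let ?E = "[:\<gamma>, 1:] * pcompose (P n) [:1, 1:] -
     ([:\<gamma> + U n / a, 1:] * P n + smult (\<alpha> n / a) ([:\<gamma> - V n / a, 1:] * P k))"
  have "?E = 0"
  proof (rule eq_0_if_orthogonal)
    fix i assume "i > k"
    then consider "i = n" | "i = Suc n" | "i \<ge> n + 2" using Suc by linarith
    then show "coeff ?E i = 0"
    proof cases
      case 1
      show ?thesis unfolding 1 coeff_diff coeff_shift_P_linear unfolding coeff_add coeff_smult coeff_linear_mult
        using a_nonzero by (simp add: Suc U_def coeff_eq_0 c_def[symmetric] field_simps)
    next
      case 2
      show ?thesis unfolding 2 coeff_diff coeff_shift_P_linear unfolding coeff_add coeff_smult coeff_linear_mult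
        by (simp add: Suc coeff_eq_0)
    next
      case 3
      then obtain j where "i = Suc j" "j > n" by (cases i) auto
      then show ?thesis unfolding coeff_diff coeff_shift_P_linear(1)[OF 3]
        unfolding coeff_add coeff_smult coeff_linear_mult by (simp add: Suc coeff_eq_0)
    qed
  next
    fix m assume m: "m \<le> k"
    have "L (?E * P m) = L ([:\<gamma>, 1:] * pcompose (P n) [:1, 1:] * P m)
       - L ([:\<gamma> + U n / a, 1:] * P n * P m) - \<alpha> n / a * L ([:\<gamma> - V n / a, 1:] * P k * P m)"
      by (simp only: left_diff_distrib distrib_right L_diff L_add L_smult mult_smult_left)
    \<comment> \<open>The factor \<open>a\<close> brings the first term into the form evaluated by
      \<open>L_shift_up_P_P\<close>.\<close>
    then have "a * L (?E * P m) = a * L ([:\<gamma>, 1:] * pcompose (P n) [:1, 1:] * P m)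
       - a * L ([:\<gamma> + U n / a, 1:] * P n * P m) - \<alpha> n * L ([:\<gamma> - V n / a, 1:] * P k * P m)"
      using a_nonzero by (simp only: right_diff_distrib mult.assoc[symmetric]) simp
    also have "\<dots> = 0"
    proof -
      consider "m = k" | "k = Suc m" | "k \<ge> m + 2" using m by linarith
      then show ?thesis
      proof cases
        case 1
        have *: "V n / a = real n + \<gamma> - \<beta> + a - b n"
          using a_nonzero by (simp add: V_def)
        show ?thesis unfolding L_linear_P_P * using 1 h_Suc[of k]
          by (subst L_shift_up_P_P) (simp_all add: Suc algebra_simps)
      next
        case 2
        then show ?thesis unfolding L_linear_P_P using h_Suc[of k]
          by (subst L_shift_up_P_P) (auto simp: Suc)
      next
        case 3
        then show ?thesis unfolding L_linear_P_P
          by (subst L_shift_up_P_P) (auto simp: Suc)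
      qed
    qed
    finally show "L (?E * P m) = 0" using a_nonzero by simp
  qed
  then show ?thesis by (simp only: right_minus_eq Suc diff_Suc_1)
qed

text \<open>Now the coefficient of \<open>x ^ (n + 1)\<close> determines \<open>V n\<close>, and the
  pairing with \<open>P n\<close> determines \<open>U (Suc n)\<close>.\<close>

lemma shift_down:
  "[:0, \<beta> - 1, 1:] * pcompose (P n) [:-1, 1:] =
     [:\<gamma> - 1 - V n / a, 1:] * P (Suc n) + smult a ([:\<gamma> - 1 + U (Suc n) / a, 1:] * P n)"
proof -
  let ?E = "[:0, \<beta> - 1, 1:] * pcompose (P n) [:-1, 1:] -
     ([:\<gamma> - 1 - V n / a, 1:] * P (Suc n) + smult a ([:\<gamma> - 1 + U (Suc n) / a, 1:] * P n))"
  have "?E = 0"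
  proof (rule eq_0_if_orthogonal)
    fix i assume "i > n"
    then consider "i = Suc n" | "i = Suc (Suc n)" | "i \<ge> n + 3" by linarith
    then show "coeff ?E i = 0"
    proof cases
      case 1
      show ?thesis unfolding 1 coeff_diff coeff_shift_P_quadratic unfolding coeff_add coeff_smult coeff_linear_mult
        using a_nonzero by (simp add: V_def coeff_eq_0 c_Suc)
    next
      case 2
      show ?thesis unfolding 2 coeff_diff coeff_shift_P_quadratic unfolding coeff_add coeff_smult coeff_linear_mult
        by (simp add: coeff_eq_0)
    next
      case 3
      then obtain j where "i = Suc j" "j > Suc n" by (cases i) auto
      then show ?thesis unfolding coeff_diff coeff_shift_P_quadratic(1)[OF 3]
        unfolding coeff_add coeff_smult coeff_linear_mult by (simp add: coeff_eq_0)
    qed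
  next
    fix m assume m: "m \<le> n"
    have "L (?E * P m) = L ([:0, \<beta> - 1, 1:] * pcompose (P n) [:-1, 1:] * P m)
       - L ([:\<gamma> - 1 - V n / a, 1:] * P (Suc n) * P m)
       - a * L ([:\<gamma> - 1 + U (Suc n) / a, 1:] * P n * P m)"
      by (simp only: left_diff_distrib distrib_right L_diff L_add L_smult mult_smult_left)
    also have "\<dots> = 0"
    proof (cases "m = n")
      case True
      have "a * ((\<gamma> - 1 + U (Suc n) / a + b n) * h n) = (a * (\<gamma> - 1 + b n) + U (Suc n)) * h n"
        using a_nonzero by (simp add: algebra_simps)
      then show ?thesis
        unfolding L_shift_down_P_P[OF m] L_linear_P_P
        using True by (simp add: U_def h_Suc algebra_simps)
    next
      case False
      then show ?thesis
        unfolding L_shift_down_P_P[OF m] L_linear_P_P using m by auto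
    qed
    finally show "L (?E * P m) = 0" .
  qed
  then show ?thesis by (simp only: right_minus_eq)
qed

section \<open>Compatibility of the shifts and the nonlinear equations\<close>

text \<open>Shifting down and back up returns a multiple of \<open>P n\<close>. Once
  \<open>P (n - 1)\<close> is eliminated by the recurrence, \<open>P (Suc n)\<close> cancels, which
  leaves \<open>D * P n = 0\<close> with \<open>P n\<close> nonzero.\<close>

lemma compatibility:
  "(x + \<gamma>) * (x + 1) * (x + \<beta>) =
     \<alpha> (Suc n) / a * (x + \<gamma> - V n / a) * (x + \<gamma> - V (Suc n) / a)
     + (a * (x + \<gamma>) + U (Suc n)) * (x + \<gamma> + U n / a)
     + (x + \<gamma> + U (Suc n) / a) * (x + \<gamma> - V n / a) * (x - b n)"
proof -
  define D where "D = [:\<gamma>, 1:] * [:1, 1:] * [:\<beta>, 1:] -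
     smult (\<alpha> (Suc n) / a) ([:\<gamma> - V n / a, 1:] * [:\<gamma> - V (Suc n) / a, 1:]) -
     [:a * \<gamma> + U (Suc n), a:] * [:\<gamma> + U n / a, 1:] -
     [:\<gamma> + U (Suc n) / a, 1:] * [:\<gamma> - V n / a, 1:] * [:- b n, 1:]"
  have D: "poly D y = (y + \<gamma>) * (y + 1) * (y + \<beta>) -
     (\<alpha> (Suc n) / a * (y + \<gamma> - V n / a) * (y + \<gamma> - V (Suc n) / a)
     + (a * (y + \<gamma>) + U (Suc n)) * (y + \<gamma> + U n / a)
     + (y + \<gamma> + U (Suc n) / a) * (y + \<gamma> - V n / a) * (y - b n))" for y
  proof -
    have "poly ([:\<gamma>, 1:] * [:1, 1:] * [:\<beta>, 1:] - smult e ([:\<gamma> - v, 1:] * [:\<gamma> - v', 1:]) -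
        [:a * \<gamma> + d, a:] * [:\<gamma> + u, 1:] - [:\<gamma> + u', 1:] * [:\<gamma> - v, 1:] * [:- b n, 1:]) y =
      (y + \<gamma>) * (y + 1) * (y + \<beta>) - (e * (y + \<gamma> - v) * (y + \<gamma> - v')
        + (a * (y + \<gamma>) + d) * (y + \<gamma> + u) + (y + \<gamma> + u') * (y + \<gamma> - v) * (y - b n))"
      for e v v' d u u' by (simp add: algebra_simps)
    then show ?thesis unfolding D_def .
  qed
  have "poly (D * P n) y = 0" for y
  proof -
    define p0 p1 q0 q1 pm where "p0 = poly (P n) y" and "p1 = poly (P (Suc n)) y"
      and "q0 = poly (P n) (y + 1)" and "q1 = poly (P (Suc n)) (y + 1)" and "pm = poly (P (n - 1)) y"
    note defs = p0_def[symmetric] p1_def[symmetric] q0_def[symmetric] q1_def[symmetric] pm_def[symmetric]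
    have lin: "poly [:g, 1:] z = z + g" for g z :: real by simp
    have F: "(y + \<gamma>) * q0 = (y + \<gamma> + U n / a) * p0 + \<alpha> n / a * ((y + \<gamma> - V n / a) * pm)"
      using arg_cong[OF shift_up[of n], of "\<lambda>p. poly p y"]
      by (simp only: poly_mult poly_add poly_smult poly_pcompose lin defs diff_Suc_1
          add.assoc[symmetric] add_diff_eq)
    have F': "(y + \<gamma>) * q1 = (y + \<gamma> + U (Suc n) / a) * p1
        + \<alpha> (Suc n) / a * ((y + \<gamma> - V (Suc n) / a) * p0)"
      using arg_cong[OF shift_up[of "Suc n"], of "\<lambda>p. poly p y"]
      by (simp only: poly_mult poly_add poly_smult poly_pcompose lin defs diff_Suc_1
          add.assoc[symmetric] add_diff_eq)
    have quad: "poly [:0, g, 1:] z = z * (z + g)" for g z :: real by (simp add: algebra_simps)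
    \<comment> \<open>Evaluation at \<open>y + 1\<close> turns \<open>P n (x - 1)\<close> into
      \<open>P n (y)\<close>.\<close>
    have "(y + 1) * (y + 1 + (\<beta> - 1)) * poly (P n) (y + 1 + - 1) =
        (y + 1 + (\<gamma> - 1 - V n / a)) * q1 + a * ((y + 1 + (\<gamma> - 1 + U (Suc n) / a)) * q0)"
      using arg_cong[OF shift_down[of n], of "\<lambda>p. poly p (y + 1)"]
      by (simp only: poly_mult poly_add poly_smult poly_pcompose lin quad defs)
    then have G: "(y + 1) * (y + \<beta>) * p0 = (y + \<gamma> - V n / a) * q1 + (a * (y + \<gamma>) + U (Suc n)) * q0"
      using a_nonzero by (simp add: p0_def[symmetric] algebra_simps)
    have "(y + 0) * p0 = p1 + b n * p0 + \<alpha> n * pm"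
      using arg_cong[OF three_term[of n], of "\<lambda>p. poly p y"]
      by (simp only: poly_mult poly_add poly_smult lin defs)
    then have T: "\<alpha> n * pm = (y - b n) * p0 - p1"
      by (simp add: algebra_simps)
    define X Y Z W e where "X = y + \<gamma> - V n / a" and "Y = y + \<gamma> + U (Suc n) / a"
      and "Z = y + \<gamma> - V (Suc n) / a" and "W = y + \<gamma> + U n / a" and "e = \<alpha> (Suc n) / a"
    note XYZ = X_def[symmetric] Y_def[symmetric] Z_def[symmetric] W_def[symmetric] e_def[symmetric]
    have aY: "a * (y + \<gamma>) + U (Suc n) = a * Y"
      using a_nonzero by (simp add: Y_def algebra_simps)
    have "a * ((y + \<gamma>) * q0) = a * (W * p0) + X * ((y - b n) * p0 - p1)"
      unfolding F T[symmetric] XYZ using a_nonzero by (simp add: algebra_simps)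
    moreover have "(y + \<gamma>) * q1 = Y * p1 + e * (Z * p0)"
      using F' unfolding XYZ .
    moreover have "(y + \<gamma>) * ((y + 1) * (y + \<beta>) * p0) = X * ((y + \<gamma>) * q1) + Y * (a * ((y + \<gamma>) * q0))"
      unfolding G aY XYZ by (simp add: algebra_simps)
    ultimately have "(y + \<gamma>) * ((y + 1) * (y + \<beta>) * p0) =
        X * (Y * p1 + e * (Z * p0)) + Y * (a * (W * p0) + X * ((y - b n) * p0 - p1))"
      by (simp only:)
    \<comment> \<open>The two terms \<open>X * Y * p1\<close> have opposite signs, so only multiples
      of \<open>p0\<close> remain.\<close>
    then show ?thesis
      unfolding poly_mult D aY XYZ p0_def[symmetric] by (simp add: algebra_simps)
  qed
  then have "D * P n = 0" by (simp add: poly_all_0_iff_0[symmetric])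
  then have "poly D x = 0" by simp
  then show ?thesis unfolding D by simp
qed

text \<open>At \<open>x + \<gamma> = V n / a\<close> the first and third terms of
  \<open>compatibility\<close> vanish.\<close>

lemma V_equation:
  "(U n + V n) * (U (Suc n) + V n) =
     V n * (V n - a * (\<gamma> - 1)) * (V n - a * (\<gamma> - \<beta>)) / a\<^sup>2"
proof -
  define v u u' where "v = V n / a" and "u = U n / a" and "u' = U (Suc n) / a"
  have eqs: "V n = a * v" "U n = a * u" "U (Suc n) = a * u'"
    using a_nonzero by (simp_all add: v_def u_def u'_def)
  have "v * (v - \<gamma> + 1) * (v - \<gamma> + \<beta>) = a * (u + v) * (u' + v)"
    using compatibility[of "v - \<gamma>" n] a_nonzero by (simp add: eqs algebra_simps)
  then have "a * (v * (v - \<gamma> + 1) * (v - \<gamma> + \<beta>)) = a * (a * (u + v) * (u' + v))"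
    by simp
  moreover have "V n * (V n - a * (\<gamma> - 1)) * (V n - a * (\<gamma> - \<beta>)) / a\<^sup>2 =
      a * (v * (v - \<gamma> + 1) * (v - \<gamma> + \<beta>))"
  proof -
    have "V n * (V n - a * (\<gamma> - 1)) * (V n - a * (\<gamma> - \<beta>)) =
        a\<^sup>2 * (a * (v * (v - \<gamma> + 1) * (v - \<gamma> + \<beta>)))"
      by (simp add: eqs algebra_simps power2_eq_square)
    then show ?thesis using a_nonzero by simp
  qed
  moreover have "(U n + V n) * (U (Suc n) + V n) = a * (a * (u + v) * (u' + v))"
    by (simp add: eqs algebra_simps)
  ultimately show ?thesis by (simp only:)
qed

text \<open>At \<open>x + \<gamma> = - U (Suc n) / a\<close> the second and third terms of
  \<open>compatibility\<close> vanish.\<close>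

lemma U_equation:
  "\<alpha> (Suc n) * ((U (Suc n) + V (Suc n)) * (U (Suc n) + V n)) =
     - (U (Suc n) * (U (Suc n) + a * (\<gamma> - 1)) * (U (Suc n) + a * (\<gamma> - \<beta>)))"
proof -
  define v v' u' e where "v = V n / a" and "v' = V (Suc n) / a"
    and "u' = U (Suc n) / a" and "e = \<alpha> (Suc n) / a"
  have eqs: "V n = a * v" "V (Suc n) = a * v'" "U (Suc n) = a * u'" "\<alpha> (Suc n) = a * e"
    using a_nonzero by (simp_all add: v_def v'_def u'_def e_def)
  have "- u' * (- u' - \<gamma> + 1) * (- u' - \<gamma> + \<beta>) = e * (u' + v) * (u' + v')"
    using compatibility[of "- u' - \<gamma>" n] a_nonzero by (simp add: eqs algebra_simps)
  then have "a ^ 3 * (- u' * (- u' - \<gamma> + 1) * (- u' - \<gamma> + \<beta>)) = a ^ 3 * (e * (u' + v) * (u' + v'))"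
    by simp
  then show ?thesis
    by (simp add: eqs algebra_simps power3_eq_cube)
qed

end

section \<open>The weight and its sums over a shifted lattice\<close>

lemma nonpos_Ints_not_pos: "(x::real) > 0 \<Longrightarrow> x \<notin> \<int>\<^sub>\<le>\<^sub>0"
  by (auto elim!: nonpos_Ints_cases)

lemma Gamma_real_nonzero: "(x::real) > 0 \<Longrightarrow> Gamma x \<noteq> 0"
  using Gamma_real_pos[of x] by linarith

lemma weight_pos:
  assumes "a > 0" "\<beta> > 0" "\<gamma> > 0" "\<beta> + x > 0" "\<gamma> + x > 0" "x + 1 > 0"
  shows "weight a \<beta> \<gamma> x > 0"
  using assms by (simp add: weight_def)

text \<open>The Pearson equation of the weight, from \<open>Gamma (y + 1) = y * Gamma y\<close> in
  each of the three Gamma factors.\<close>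

lemma weight_plus_1:
  assumes "a > 0" "\<beta> + x > 0" "\<gamma> + x > 0" "x + 1 > 0"
  shows "(\<beta> + x) * (x + 1) * weight a \<beta> \<gamma> (x + 1) = a * (\<gamma> + x) * weight a \<beta> \<gamma> x"
proof -
  have G: "Gamma (y + 1) = y * Gamma y" if "y > 0" for y :: real
    using that by (intro Gamma_plus1 nonpos_Ints_not_pos)
  have "Gamma (\<gamma> + (x + 1)) = (\<gamma> + x) * Gamma (\<gamma> + x)"
    and "Gamma (\<beta> + (x + 1)) = (\<beta> + x) * Gamma (\<beta> + x)"
    and "Gamma (x + 1 + 1) = (x + 1) * Gamma (x + 1)"
    using G[of "\<gamma> + x"] G[of "\<beta> + x"] G[of "x + 1"] assms by (simp_all add: add_ac)
  then show ?thesis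
    using assms Gamma_real_nonzero[of "\<beta> + x"] Gamma_real_nonzero[of "x + 1"]
    unfolding weight_def by (simp add: powr_add divide_simps)
qed

text \<open>Offset \<open>0\<close> gives the first lattice and offset \<open>1 - \<beta>\<close>
  the second.\<close>

definition lattice_sum :: "real \<Rightarrow> real \<Rightarrow> real \<Rightarrow> real \<Rightarrow> real poly \<Rightarrow> real" where
  "lattice_sum a \<beta> \<gamma> s p = (\<Sum>k. poly p (real k + s) * weight a \<beta> \<gamma> (real k + s))"

locale lattice_weight =
  fixes a \<beta> \<gamma> s :: real
  assumes a_pos: "a > 0" and \<beta>_pos: "\<beta> > 0" and \<gamma>_pos: "\<gamma> > 0"
    and \<beta>_s: "\<beta> + s > 0" and \<gamma>_s: "\<gamma> + s > 0" and s_1: "s + 1 > 0"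
    and boundary: "s * (s + \<beta> - 1) = 0"
begin

abbreviation w where "w k \<equiv> weight a \<beta> \<gamma> (real k + s)"

lemma w_pos: "w k > 0"
  using a_pos \<beta>_pos \<gamma>_pos \<beta>_s \<gamma>_s s_1 by (intro weight_pos) auto

lemma w_Suc: "(\<beta> + (real k + s)) * (real k + s + 1) * w (Suc k) = a * (\<gamma> + (real k + s)) * w k"
  using weight_plus_1[of a \<beta> "real k + s" \<gamma>] a_pos \<beta>_s \<gamma>_s s_1 by (simp add: add_ac)

text \<open>Ratio test: the weight ratios tend to \<open>0\<close> and the power ratios to
  \<open>1\<close>. Powers of \<open>k + 1\<close> keep every term positive.\<close>

lemma summable_power_w: "summable (\<lambda>k. (real k + 1) ^ j * w k)"
proof -
  define q where "q k = a * (\<gamma> + s + real k) / ((\<beta> + s + real k) * (s + real k + 1))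
      * ((real k + 2) / (real k + 1)) ^ j" for k
  have "(\<lambda>k. a * (\<gamma> + s + real k) / ((\<beta> + s + real k) * (s + real k + 1))) \<longlonglongrightarrow> 0"
    using a_pos \<gamma>_s \<beta>_s s_1 by real_asymp
  moreover have "(\<lambda>k. (real k + 2) / (real k + 1)) \<longlonglongrightarrow> 1"
    by real_asymp
  ultimately have "q \<longlonglongrightarrow> 0 * 1 ^ j"
    unfolding q_def by (intro tendsto_intros)
  then have "eventually (\<lambda>k. q k < 1/2) sequentially"
    by (intro order_tendstoD) auto
  then obtain N where N: "\<And>k. k \<ge> N \<Longrightarrow> q k < 1/2"
    by (auto simp: eventually_sequentially)
  have step: "(real (Suc k) + 1) ^ j * w (Suc k) = q k * ((real k + 1) ^ j * w k)" for k
  proof -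
    have pos: "\<beta> + s + real k > 0" "s + real k + 1 > 0"
      using \<beta>_s s_1 by auto
    have "w (Suc k) = a * (\<gamma> + s + real k) / ((\<beta> + s + real k) * (s + real k + 1)) * w k"
    proof -
      have "w (Suc k) * ((\<beta> + s + real k) * (s + real k + 1)) = a * (\<gamma> + s + real k) * w k"
        using w_Suc[of k] by (simp add: mult_ac add_ac)
      then have "w (Suc k) = a * (\<gamma> + s + real k) * w k / ((\<beta> + s + real k) * (s + real k + 1))"
        using pos by (intro eq_divide_imp) auto
      then show ?thesis by simp
    qed
    then show ?thesis
      by (simp add: q_def power_divide add_ac)
  qed
  show ?thesis
  proof (rule summable_ratio_test[of "1/2" N])
    fix k assume "k \<ge> N"
    then have "q k * ((real k + 1) ^ j * w k) \<le> 1/2 * ((real k + 1) ^ j * w k)"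
      using N w_pos[of k] by (intro mult_right_mono) (auto intro: less_imp_le)
    moreover have nonneg: "0 \<le> (real i + 1) ^ j * w i" for i
      using w_pos[of i] by simp
    ultimately show "norm ((real (Suc k) + 1) ^ j * w (Suc k)) \<le> 1/2 * norm ((real k + 1) ^ j * w k)"
      unfolding real_norm_def abs_of_nonneg[OF nonneg] by (simp only: step)
  qed simp
qed

lemma summable_poly_w: "summable (\<lambda>k. poly p (real k + s) * w k)"
proof -
  \<comment> \<open>Since \<open>k + s = (k + 1) + (s - 1)\<close>, this re-expands \<open>p\<close>
    in powers of \<open>k + 1\<close>.\<close>
  let ?q = "pcompose p [:s - 1, 1:]"
  have "summable (\<lambda>k. \<Sum>j\<le>degree ?q. coeff ?q j * ((real k + 1) ^ j * w k))"
    by (intro summable_sum summable_mult summable_power_w)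
  moreover have "(\<Sum>j\<le>degree ?q. coeff ?q j * ((real k + 1) ^ j * w k)) = poly p (real k + s) * w k" for k
  proof -
    have "poly p (real k + s) = poly ?q (real k + 1)"
      by (simp add: poly_pcompose add_ac)
    then show ?thesis
      by (simp only: poly_altdef sum_distrib_right mult.assoc)
  qed
  ultimately show ?thesis by simp
qed

lemma lattice_sum_add:
  "lattice_sum a \<beta> \<gamma> s (p + q) = lattice_sum a \<beta> \<gamma> s p + lattice_sum a \<beta> \<gamma> s q"
  by (simp add: lattice_sum_def distrib_right suminf_add[OF summable_poly_w summable_poly_w])

lemma lattice_sum_smult: "lattice_sum a \<beta> \<gamma> s (smult c p) = c * lattice_sum a \<beta> \<gamma> s p"
  by (simp add: lattice_sum_def mult.assoc suminf_mult[OF summable_poly_w])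

text \<open>Summation by shifting the index: \<open>boundary\<close> removes the first term, and
  \<open>w_Suc\<close> rewrites the others.\<close>

lemma lattice_sum_pearson:
  "lattice_sum a \<beta> \<gamma> s ([:0, \<beta> - 1, 1:] * p) = a * lattice_sum a \<beta> \<gamma> s ([:\<gamma>, 1:] * pcompose p [:1, 1:])"
proof -
  let ?f = "\<lambda>k. poly ([:0, \<beta> - 1, 1:] * p) (real k + s) * w k"
  have "?f 0 = s * (s + \<beta> - 1) * poly p s * w 0"
    by (simp add: algebra_simps)
  then have f_0: "?f 0 = 0" by (simp only: boundary mult_zero_left)
  have f_Suc: "?f (Suc k) = a * (poly ([:\<gamma>, 1:] * pcompose p [:1, 1:]) (real k + s) * w k)" for k
  proof -
    have "?f (Suc k) = poly p (real k + s + 1) * ((\<beta> + (real k + s)) * (real k + s + 1) * w (Suc k))"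
      by (simp add: algebra_simps)
    also have "\<dots> = poly p (real k + s + 1) * (a * (\<gamma> + (real k + s)) * w k)"
      by (simp only: w_Suc)
    finally show ?thesis
      by (simp add: poly_pcompose algebra_simps)
  qed
  have "lattice_sum a \<beta> \<gamma> s ([:0, \<beta> - 1, 1:] * p) = (\<Sum>k. ?f (Suc k))"
    unfolding lattice_sum_def using f_0 suminf_split_head[OF summable_poly_w[of "[:0, \<beta> - 1, 1:] * p"]]
    by linarith
  also have "\<dots> = (\<Sum>k. a * (poly ([:\<gamma>, 1:] * pcompose p [:1, 1:]) (real k + s) * w k))"
    by (simp only: f_Suc)
  also have "\<dots> =
      a * lattice_sum a \<beta> \<gamma> s ([:\<gamma>, 1:] * pcompose p [:1, 1:])"
    unfolding lattice_sum_def by (rule suminf_mult[OF summable_poly_w])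
  finally show ?thesis .
qed

end

section \<open>The first two moments as Kummer functions\<close>

lemma pochhammer_shift_Gamma:
  "x > 0 \<Longrightarrow> Gamma (x + real k) = pochhammer x k * Gamma x" for x :: real
  using pochhammer_Gamma[of x k] Gamma_real_nonzero[of x] nonpos_Ints_not_pos[of x] by simp

lemma lattice_sum_0_1:
  assumes "a > 0" "\<beta> > 0" "\<gamma> > 0"
  shows "lattice_sum a \<beta> \<gamma> 0 1 = m0 a \<beta> \<gamma>"
  unfolding lattice_sum_def m0_def kummer_M_def
proof (rule suminf_cong)
  fix k
  show "poly 1 (real k + 0) * weight a \<beta> \<gamma> (real k + 0) = pochhammer \<gamma> k / (pochhammer \<beta> k * fact k) * a ^ k"
    using assms Gamma_real_nonzero[of \<beta>] Gamma_real_nonzero[of \<gamma>] Gamma_fact[of k, where 'a=real]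
    by (simp add: weight_def pochhammer_shift_Gamma powr_realpow add_ac)
qed

lemma lattice_sum_0_x:
  assumes "a > 0" "\<beta> > 0" "\<gamma> > 0"
  shows "lattice_sum a \<beta> \<gamma> 0 [:0, 1:] = m1 a \<beta> \<gamma>"
proof -
  interpret lattice_weight a \<beta> \<gamma> 0
    using assms by unfold_locales auto
  \<comment> \<open>The term at \<open>x = 0\<close> drops out; afterwards the factor
    \<open>k + 1\<close> cancels against \<open>fact (Suc k)\<close>.\<close>
  have "lattice_sum a \<beta> \<gamma> 0 [:0, 1:] = (\<Sum>k. real (Suc k) * weight a \<beta> \<gamma> (real (Suc k)))"
    using suminf_split_head[OF summable_poly_w[of "[:0, 1:]"]] by (simp add: lattice_sum_def)
  also have "\<dots> = (\<Sum>k. \<gamma> * a / \<beta> * (pochhammer (\<gamma> + 1) k / (pochhammer (\<beta> + 1) k * fact k) * a ^ k))"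
  proof (rule suminf_cong)
    fix k
    have w: "weight a \<beta> \<gamma> (real (Suc k)) = pochhammer \<gamma> (Suc k) / (pochhammer \<beta> (Suc k) * fact (Suc k)) * a ^ Suc k"
      using assms Gamma_real_nonzero[of \<beta>] Gamma_real_nonzero[of \<gamma>] Gamma_fact[of "Suc k", where 'a=real]
        pochhammer_shift_Gamma[of \<beta> "Suc k"] pochhammer_shift_Gamma[of \<gamma> "Suc k"]
        powr_realpow[of a "Suc k"]
      by (simp only: weight_def) (simp add: add_ac del: power_Suc)
    show "real (Suc k) * weight a \<beta> \<gamma> (real (Suc k)) =
        \<gamma> * a / \<beta> * (pochhammer (\<gamma> + 1) k / (pochhammer (\<beta> + 1) k * fact k) * a ^ k)"
      unfolding w pochhammer_rec fact_Suc by (simp add: divide_simps)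
  qed
  also have "\<dots> = m1 a \<beta> \<gamma>"
    unfolding m1_def kummer_M_def
    using assms nonpos_Ints_not_pos[of "\<beta> + 1"] by (intro suminf_mult kummer_M_summable) auto
  finally show ?thesis .
qed

text \<open>On this lattice \<open>Gamma (\<beta> + x)\<close> becomes \<open>fact k\<close>. The
  other denominator is written with \<open>rGamma\<close>, ready to absorb a factor \<open>x\<close>
  even at \<open>\<beta> = 1\<close>.\<close>

lemma weight_shifted:
  assumes "a > 0" "\<beta> < 2" "\<gamma> > \<beta> - 1"
  shows "weight a \<beta> \<gamma> (real k + (1 - \<beta>)) = Gamma \<beta> * Gamma (\<gamma> - \<beta> + 1) / Gamma \<gamma> * a powr (1 - \<beta>)
    * (pochhammer (\<gamma> - \<beta> + 1) k * rGamma (1 - \<beta> + real k + 1) / fact k * a ^ k)"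
proof -
  have "Gamma (\<gamma> + (real k + (1 - \<beta>))) = pochhammer (\<gamma> - \<beta> + 1) k * Gamma (\<gamma> - \<beta> + 1)"
    using pochhammer_shift_Gamma[of "\<gamma> - \<beta> + 1" k] assms by (simp add: algebra_simps)
  moreover have "a powr (real k + (1 - \<beta>)) = a ^ k * a powr (1 - \<beta>)"
    using assms by (simp add: powr_add powr_realpow)
  moreover have "Gamma (\<beta> + (real k + (1 - \<beta>))) = fact k"
    using Gamma_fact[of k, where 'a=real] by (simp add: algebra_simps)
  moreover have "rGamma (1 - \<beta> + real k + 1) = inverse (Gamma (real k + (1 - \<beta>) + 1))"
    by (simp add: rGamma_inverse_Gamma algebra_simps)
  ultimately show ?thesis
    unfolding weight_def by (simp add: field_simps)
qed

lemma lattice_sum_shifted_1: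
  assumes "a > 0" "\<beta> > 0" "\<beta> < 2" "\<gamma> > 0" "\<gamma> > \<beta> - 1"
  shows "lattice_sum a \<beta> \<gamma> (1 - \<beta>) 1 = m0_hat a \<beta> \<gamma>"
proof -
  have ni: "2 - \<beta> \<notin> \<int>\<^sub>\<le>\<^sub>0" using assms by (intro nonpos_Ints_not_pos) simp
  have "lattice_sum a \<beta> \<gamma> (1 - \<beta>) 1 = (\<Sum>k. Gamma \<beta> * Gamma (\<gamma> - \<beta> + 1) / (Gamma \<gamma> * Gamma (2 - \<beta>))
     * a powr (1 - \<beta>) * (pochhammer (\<gamma> - \<beta> + 1) k / (pochhammer (2 - \<beta>) k * fact k) * a ^ k))"
    unfolding lattice_sum_def
  proof (rule suminf_cong)
    fix k
    have "Gamma (2 - \<beta> + real k) = pochhammer (2 - \<beta>) k * Gamma (2 - \<beta>)"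
      using assms by (intro pochhammer_shift_Gamma) simp
    then have "rGamma (1 - \<beta> + real k + 1) = inverse (pochhammer (2 - \<beta>) k * Gamma (2 - \<beta>))"
      by (simp add: rGamma_inverse_Gamma algebra_simps)
    then show "poly 1 (real k + (1 - \<beta>)) * weight a \<beta> \<gamma> (real k + (1 - \<beta>)) =
       Gamma \<beta> * Gamma (\<gamma> - \<beta> + 1) / (Gamma \<gamma> * Gamma (2 - \<beta>))
       * a powr (1 - \<beta>) * (pochhammer (\<gamma> - \<beta> + 1) k / (pochhammer (2 - \<beta>) k * fact k) * a ^ k)"
      using assms by (simp add: weight_shifted divide_inverse)
  qed
  also have "\<dots> = m0_hat a \<beta> \<gamma>"
    unfolding m0_hat_def kummer_M_def by (rule suminf_mult[OF kummer_M_summable[OF ni]])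
  finally show ?thesis .
qed

lemma lattice_sum_shifted_x:
  assumes "a > 0" "\<beta> > 0" "\<beta> < 2" "\<gamma> > 0" "\<gamma> > \<beta> - 1"
  shows "lattice_sum a \<beta> \<gamma> (1 - \<beta>) [:0, 1:] = m1_hat a \<beta> \<gamma>"
proof -
  interpret lattice_weight a \<beta> \<gamma> "1 - \<beta>"
    using assms by unfold_locales auto
  define C where "C = Gamma \<beta> * Gamma (\<gamma> - \<beta> + 1) / Gamma \<gamma> * a powr (1 - \<beta>)"
  have C: "C \<noteq> 0"
    using assms Gamma_real_nonzero[of \<beta>] Gamma_real_nonzero[of \<gamma>] Gamma_real_nonzero[of "\<gamma> - \<beta> + 1"]
    by (simp add: C_def)
  \<comment> \<open>With \<open>x = 1 - \<beta> + k\<close> this is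
    \<open>x * rGamma (x + 1) = rGamma x\<close>, valid also at the poles of
    \<open>Gamma\<close>.\<close>
  have eq: "poly [:0, 1:] (real k + (1 - \<beta>)) * w k =
      C * (pochhammer (\<gamma> - \<beta> + 1) k * rGamma (1 - \<beta> + real k) / fact k * a ^ k)" for k
    unfolding weight_shifted[OF assms(1,3,5)] C_def[symmetric] rGamma_plus1[of "1 - \<beta> + real k", symmetric]
    by (simp add: ac_simps)
  \<comment> \<open>Summability is inherited from the lattice sum: \<open>kummer_M_summable\<close>
    does not apply when \<open>1 - \<beta> = 0\<close>.\<close>
  have "summable (\<lambda>k. C * (pochhammer (\<gamma> - \<beta> + 1) k * rGamma (1 - \<beta> + real k) / fact k * a ^ k))"
    using summable_poly_w[of "[:0, 1:]"] unfolding eq .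
  then have "summable (\<lambda>k. pochhammer (\<gamma> - \<beta> + 1) k * rGamma (1 - \<beta> + real k) / fact k * a ^ k)"
    using C by (rule summable_mult_D)
  then show ?thesis
    unfolding lattice_sum_def eq m1_hat_def kummer_M_over_Gamma_def C_def[symmetric]
    by (rule suminf_mult)
qed

section \<open>Application to the bi-lattice\<close>

text \<open>Writing both cases as one linear combination lets \<open>t = \<infinity>\<close> and
  finite \<open>t\<close> share the whole argument.\<close>

lemma inner_bilattice_lattice_sum:
  "inner_bilattice a \<beta> \<gamma> t p q =
     (if t = \<infinity> then 0 else 1) * lattice_sum a \<beta> \<gamma> 0 (p * q) +
     (if t = \<infinity> then 1 else enn2real t) * lattice_sum a \<beta> \<gamma> (1 - \<beta>) (p * q)"
  by (simp add: inner_bilattice_def inner_N_def inner_shifted_def lattice_sum_def add_diff_eq)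

theorem theorem3p3:
  fixes a \<beta> \<gamma> :: real and t :: ennreal
    and r :: "nat \<Rightarrow> real poly" and A B :: "nat \<Rightarrow> real"
  assumes "a > 0" and "0 < \<beta>" and "\<beta> < 2"
    and "\<gamma> > max 0 (\<beta> - 1)" and "\<gamma> \<noteq> 1"
    and "orthonormal_polys a \<beta> \<gamma> t r"
    and "recurrence_coeffs r A B"
  shows "\<exists>u v :: nat \<Rightarrow> real.
     (\<forall>n. (A n)\<^sup>2 = real n * a - (\<gamma> - 1) * u n) \<and>
     (\<forall>n. B n = real n + \<gamma> - \<beta> + a - (\<gamma> - 1) * v n / a) \<and>
     (\<forall>n. (u n + v n) * (u (n + 1) + v n) =
        (\<gamma> - 1) / a\<^sup>2 * v n * (v n - a) * (v n - a * ((\<gamma> - \<beta>) / (\<gamma> - 1)))) \<and>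
     (\<forall>n\<ge>1. u n - a * real n / (\<gamma> - 1) \<noteq> 0 \<and>
        (u n + v n) * (u n + v (n - 1)) =
        u n / (u n - a * real n / (\<gamma> - 1)) * (u n + a) * (u n + a * ((\<gamma> - \<beta>) / (\<gamma> - 1)))) \<and>
     A 0 = 0 \<and>
     B 0 = (if t = \<infinity> then m1_hat a \<beta> \<gamma> / m0_hat a \<beta> \<gamma>
            else (m1 a \<beta> \<gamma> + enn2real t * m1_hat a \<beta> \<gamma>)
                 / (m0 a \<beta> \<gamma> + enn2real t * m0_hat a \<beta> \<gamma>))"
proof -
  have \<gamma>: "\<gamma> > 0" "\<gamma> > \<beta> - 1" and g: "\<gamma> - 1 \<noteq> 0"
    using \<open>\<gamma> > max 0 (\<beta> - 1)\<close> \<open>\<gamma> \<noteq> 1\<close> by auto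
  interpret N: lattice_weight a \<beta> \<gamma> 0
    using assms \<gamma> by unfold_locales auto
  interpret S: lattice_weight a \<beta> \<gamma> "1 - \<beta>"
    using assms \<gamma> by unfold_locales auto
  define c0 c1 where "c0 = (if t = \<infinity> then 0 else 1 :: real)"
    and "c1 = (if t = \<infinity> then 1 else enn2real t)"
  define L where "L p = c0 * lattice_sum a \<beta> \<gamma> 0 p + c1 * lattice_sum a \<beta> \<gamma> (1 - \<beta>) p" for p
  have degree_r: "degree (r n) = n" and lead_r: "lead_coeff (r n) > 0"
    and L_r_r: "L (r n * r m) = (if n = m then 1 else 0)" for n m
    using \<open>orthonormal_polys a \<beta> \<gamma> t r\<close>
    unfolding orthonormal_polys_def inner_bilattice_lattice_sum c0_def[symmetric] c1_def[symmetric]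
      L_def[symmetric] by blast+
  define l where "l n = lead_coeff (r n)" for n
  have l_pos: "l n > 0" and l_coeff: "coeff (r n) n = l n" for n
    using lead_r[of n] by (simp_all add: l_def degree_r)
  have A_0: "A 0 = 0" and rec: "x * poly (r n) x = A (Suc n) * poly (r (Suc n)) x + B n * poly (r n) x
      + (if n = 0 then 0 else A n * poly (r (n - 1)) x)" for n x
    using \<open>recurrence_coeffs r A B\<close> unfolding recurrence_coeffs_def by blast+
  \<comment> \<open>Because \<open>A 0 = 0\<close>, the case distinction at \<open>n = 0\<close>
    disappears.\<close>
  have rec_poly: "[:0, 1:] * r n = smult (A (Suc n)) (r (Suc n)) + smult (B n) (r n) + smult (A n) (r (n - 1))"
    for n
    by (rule poly_eq_poly_eq_iff[THEN iffD1], rule ext) (use rec[of _ n] A_0 in simp)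
  \<comment> \<open>Comparing leading coefficients shows that \<open>A (Suc n)\<close> is a ratio of
    positive numbers.\<close>
  have l_rec: "l n = A (Suc n) * l (Suc n)" for n
  proof -
    have "coeff ([:0, 1:] * r n) (Suc n) = l n" by (simp add: l_coeff degree_r coeff_eq_0)
    then show ?thesis unfolding rec_poly by (simp add: l_coeff degree_r coeff_eq_0)
  qed
  have A_Suc: "A (Suc n) = l n / l (Suc n)" and A_nonzero: "A (Suc n) \<noteq> 0" for n
    using l_rec[of n] l_pos[of n] l_pos[of "Suc n"] by (auto simp: field_simps)
  \<comment> \<open>Monic normalisation: the squared norms become \<open>1 / (l n)\<^sup>2\<close>,
    and the recurrence coefficients become \<open>B n\<close> and
    \<open>(A n)\<^sup>2\<close>.\<close>
  define P where "P n = smult (1 / l n) (r n)" for n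
  have l_nz: "l n \<noteq> 0" for n using l_pos[of n] by simp
  interpret O: pearson_orthogonal_polys L P "\<lambda>n. 1 / (l n)\<^sup>2" B "\<lambda>n. (A n)\<^sup>2" a \<beta> \<gamma>
  proof
    show L_smult: "L (smult k p) = k * L p" for k p
      by (simp add: L_def N.lattice_sum_smult S.lattice_sum_smult algebra_simps)
    show "L (p + q) = L p + L q" for p q
      by (simp add: L_def N.lattice_sum_add S.lattice_sum_add algebra_simps)
    show "degree (P n) = n" for n
      by (simp add: P_def degree_r l_nz)
    then show "lead_coeff (P n) = 1" for n
      by (simp add: P_def l_coeff l_nz)
    show "L (P n * P m) = (if n = m then 1 / (l n)\<^sup>2 else 0)" for n m
      by (simp add: P_def L_smult L_r_r power2_eq_square)
    show "1 / (l n)\<^sup>2 \<noteq> 0" for n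
      by (simp add: l_nz)
    show "(A 0)\<^sup>2 = 0" by (simp add: A_0)
    show "L ([:0, \<beta> - 1, 1:] * p) = a * L ([:\<gamma>, 1:] * pcompose p [:1, 1:])" for p
      unfolding L_def N.lattice_sum_pearson S.lattice_sum_pearson by (simp add: algebra_simps)
    show "a \<noteq> 0" using \<open>a > 0\<close> by simp
    show "[:0, 1:] * P n = P (Suc n) + smult (B n) (P n) + smult ((A n)\<^sup>2) (P (n - 1))" for n
    proof -
      have 1: "1 / l n * A (Suc n) = 1 / l (Suc n)"
        using l_nz by (simp add: A_Suc)
      have 2: "1 / l n * A n = (A n)\<^sup>2 * (1 / l (n - 1))"
        using l_nz by (cases n) (simp_all add: A_0 A_Suc power2_eq_square)
      have "[:0, 1:] * P n = smult (1 / l n) ([:0, 1:] * r n)"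
        unfolding P_def by (simp only: mult_smult_right)
      also have "\<dots> = smult (1 / l n * A (Suc n)) (r (Suc n)) + smult (B n) (smult (1 / l n) (r n))
          + smult (1 / l n * A n) (r (n - 1))"
        unfolding rec_poly by (simp add: smult_add_right mult.commute)
      finally show ?thesis
        unfolding 1 2 P_def smult_smult .
    qed
  qed
  \<comment> \<open>Only here is the division by \<open>\<gamma> - 1\<close> carried out.\<close>
  define u v where "u n = O.U n / (\<gamma> - 1)" and "v n = O.V n / (\<gamma> - 1)" for n
  have U: "O.U n = (\<gamma> - 1) * u n" and V: "O.V n = (\<gamma> - 1) * v n" for n
    using g by (simp_all add: u_def v_def)
  define \<kappa> where "\<kappa> = a * ((\<gamma> - \<beta>) / (\<gamma> - 1))"
  define d where "d = \<gamma> - 1"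
  have d: "d \<noteq> 0" and d2: "d\<^sup>2 \<noteq> 0" using g by (simp_all add: d_def)
  have k: "a * (\<gamma> - \<beta>) = d * \<kappa>"
    using g by (simp add: d_def \<kappa>_def)
  have A_eq: "(A n)\<^sup>2 = real n * a - d * u n" for n
    using U[of n] by (simp add: O.U_def d_def)
  have B_eq: "B n = real n + \<gamma> - \<beta> + a - d * v n / a" for n
    using V[of n] \<open>a > 0\<close> unfolding O.V_def d_def by (simp add: field_simps)
  have eq1: "(u n + v n) * (u (n + 1) + v n) = d / a\<^sup>2 * v n * (v n - a) * (v n - \<kappa>)" for n
  proof -
    have "d\<^sup>2 * ((u n + v n) * (u (Suc n) + v n)) = (d * u n + d * v n) * (d * u (Suc n) + d * v n)"
      by (simp add: algebra_simps power2_eq_square)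
    also have "\<dots> = d * v n * (d * v n - a * d) * (d * v n - d * \<kappa>) / a\<^sup>2"
      using O.V_equation[of n] unfolding U V k d_def .
    also have "\<dots> = d\<^sup>2 * (d / a\<^sup>2 * v n * (v n - a) * (v n - \<kappa>))"
    proof -
      have "d * v n * (d * v n - a * d) * (d * v n - d * \<kappa>) = d\<^sup>2 * (d * v n * (v n - a) * (v n - \<kappa>))"
        by (simp add: algebra_simps power2_eq_square)
      then show ?thesis by simp
    qed
    finally show ?thesis unfolding Suc_eq_plus1 mult_left_cancel[OF d2] .
  qed
  have eq2: "u n - a * real n / d \<noteq> 0 \<and>
      (u n + v n) * (u n + v (n - 1)) = u n / (u n - a * real n / d) * (u n + a) * (u n + \<kappa>)"
    if "n \<ge> 1" for n
  proof -
    obtain m where n: "n = Suc m" using \<open>n \<ge> 1\<close> by (cases n) auto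
    \<comment> \<open>This denominator equals \<open>- (A n)\<^sup>2 / d\<close>, hence is nonzero
      for \<open>n \<ge> 1\<close>.\<close>
    define e where "e = u n - a * real n / d"
    have e: "(A n)\<^sup>2 = - d * e"
      using A_eq[of n] d by (simp add: e_def algebra_simps)
    then have e_nz: "e \<noteq> 0" using A_nonzero[of m] by (auto simp: n)
    have "- d * e * ((d * u n + d * v n) * (d * u n + d * v m)) =
        - (d * u n * (d * u n + a * d) * (d * u n + d * \<kappa>))"
      using O.U_equation[of m] unfolding n[symmetric] U V k d_def[symmetric] e .
    then have "d ^ 3 * (e * ((u n + v n) * (u n + v m))) = d ^ 3 * (u n * (u n + a) * (u n + \<kappa>))"
      by (simp add: algebra_simps power3_eq_cube)
    then have "e * ((u n + v n) * (u n + v m)) = u n * (u n + a) * (u n + \<kappa>)"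
      using d by simp
    then have "(u n + v n) * (u n + v m) = u n / e * (u n + a) * (u n + \<kappa>)"
      using e_nz by (simp add: field_simps)
    then show ?thesis using e_nz by (simp add: e_def n)
  qed
  \<comment> \<open>Since \<open>P 0 = 1\<close>, the pairing of \<open>x * P 0\<close> with
    \<open>P 0\<close> expresses \<open>B 0\<close> as first moment over zeroth moment.\<close>
  have "L [:0, 1:] = B 0 * L 1" and "L 1 \<noteq> 0"
    using O.L_linear_P_P[of 0 0 0] O.L_P_P[of 0 0] l_nz by (simp_all add: O.P_0)
  then have "B 0 = L [:0, 1:] / L 1" by simp
  then have B_0: "B 0 = (if t = \<infinity> then m1_hat a \<beta> \<gamma> / m0_hat a \<beta> \<gamma>
       else (m1 a \<beta> \<gamma> + enn2real t * m1_hat a \<beta> \<gamma>) / (m0 a \<beta> \<gamma> + enn2real t * m0_hat a \<beta> \<gamma>))"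
    using assms \<gamma> by (simp add: L_def c0_def c1_def lattice_sum_0_1 lattice_sum_0_x
        lattice_sum_shifted_1 lattice_sum_shifted_x)
  show ?thesis
    using A_eq B_eq eq1 eq2 A_0 B_0 unfolding d_def \<kappa>_def by blast
qed

end
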